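(* Let $Y$ be a smooth Calabi-Yau threefold and $C\simeq\mathbb P^1\subset Y$ a smoothly embedded contractible rational curve, with local genus zero Gopakumar-Vafa spectrum $(n_d)_{d\ge1}$, support $S=\{d\ge1:n_d\neq0\}$, $g=\gcd S$, and nonconstant local Gromov-Witten contribution $\mathcal F_C^{\mathrm{loc}}=\sum_{d\in S}n_d\Phi_d$. Then $$\Delta_g\mathcal F_C^{\mathrm{loc}}=D^2\sum_{d\in S}\frac{n_d}{d^2}\,K_{d/g}(T_{h/d})\,\mathrm{Li}_3(q^d).$$ Equivalently, $$\Delta_g\mathcal F_C^{\mathrm{loc}}=-\sum_{d\in S}n_d\,K_{d/g}(T_{h/d})\,\mathrm{Li}_1(q^d).$$
   Context: The local genus zero Gopakumar-Vafa spectrum of $C$ is the finite sequence of integers $n_1,\dots,n_\ell$ given by the Bryan-Katz-Leung Hilbert scheme multiplicities of $C$ in degrees $1\le d\le\ell$, where $1\le\ell\le6$ is Kollár's length; set $n_d=0$ for $d>\ell$. The support $S$ is finite and nonempty. For $d\ge1$, $$\Phi_d(\lambda,t)=\sum_{k\ge1}\frac{q^{dk}}{k(2\sin(k\lambda/2))^2}\in\mathbb C((\lambda))[[q]],\qquad q=e^{2\pi it}.$$ Put $h=\lambda/(2\pi)$, $D=\frac1{2\pi}\frac{\partial}{\partial t}$ (so $Dq^N=iNq^N$), and $T_af(t)=f(t+a)$ (so $T_aq^N=e^{2\pi iNa}q^N$). Define $\Delta_g=T_{h/g}-2+T_{-h/g}$. For $m\ge1$, $$K_m(z)=\sum_{j=-(m-1)}^{m-1}(m-|j|)z^j,$$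 and $K_m(T_a)=\sum_{j}(m-|j|)T_{ja}$ is the corresponding finite combination of shifts. The polylogarithm is $\mathrm{Li}_s(z)=\sum_{k\ge1}z^k/k^s$. All identities are between formal power series in $q$. *)

theory Defs
  imports "HOL-Computational_Algebra.Computational_Algebra" Complex_Main
begin

text \<open>
  The ring \<open>\<complex>((\<lambda>))[[q]]\<close> is \<^typ>\<open>complex fls fps\<close>: the inner Laurent variable is \<open>\<lambda>\<close>, the outer
  power series variable is \<open>q\<close>.
\<close>

type_synonym qseries = "complex fls fps"

definition scal :: "complex \<Rightarrow> qseries"
  where "scal c = fps_const (fls_const c)"

definition q :: qseries
  where "q = fps_X"

text \<open>
  Sums \<open>\<Sum>k\<ge>1. c k * q^(d*k)\<close> with \<open>d \<ge> 1\<close> are written as the composition of \<open>\<Sum>k\<ge>1. c k * z^k\<close>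
  with \<open>z = q^d\<close>; this is legitimate because \<open>q^d\<close> has zero constant coefficient.
\<close>

definition Phi :: "nat \<Rightarrow> qseries"
  where "Phi d =
    Abs_fps (\<lambda>k. if k = 0 then 0
       else 1 / (of_nat k * fps_to_fls (2 * fps_sin (of_nat k / 2)) ^ 2)) oo q ^ d"

definition polylog :: "nat \<Rightarrow> qseries \<Rightarrow> qseries"
  where "polylog s z =
    Abs_fps (\<lambda>k. if k = 0 then 0 else fls_const (1 / of_nat k ^ s)) oo z"

text \<open>\<open>h = \<lambda>/(2\<pi>)\<close>, as a power series in \<open>\<lambda>\<close>.\<close>

definition h :: "complex fps"
  where "h = fps_const (1 / (2 * of_real pi)) * fps_X"

text \<open>
  \<open>shift a\<close> is \<open>T\<^sub>a\<close>, i.e. \<open>q^N \<mapsto> exp(2\<pi>iNa) q^N\<close>, extended \<open>\<complex>((\<lambda>))\<close>-linearly and coefficientwise.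
  The amount \<open>a\<close> is a power series in \<open>\<lambda>\<close>; the exponential is meaningful only if \<open>a\<close> has zero
  constant coefficient, as all rational multiples of \<^const>\<open>h\<close> do.
\<close>

definition shift :: "complex fps \<Rightarrow> qseries \<Rightarrow> qseries"
  where "shift a F =
    Abs_fps (\<lambda>N. fps_to_fls (fps_exp (2 * of_real pi * \<i> * of_nat N) oo a) * fps_nth F N)"

text \<open>Since \<open>q = exp(2\<pi>it)\<close>, the derivation \<open>\<partial>/\<partial>t\<close> is \<open>2\<pi>i q d/dq\<close>.\<close>

definition deriv_t :: "qseries \<Rightarrow> qseries"
  where "deriv_t F = scal (2 * of_real pi * \<i>) * q * fps_deriv F"

definition D :: "qseries \<Rightarrow> qseries"
  where "D F = scal (1 / (2 * of_real pi)) * deriv_t F"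

definition Delta :: "nat \<Rightarrow> qseries \<Rightarrow> qseries"
  where "Delta g F =
    shift (fps_const (1 / of_nat g) * h) F - 2 * F + shift (- (fps_const (1 / of_nat g) * h)) F"

text \<open>\<open>K_shift m a\<close> is \<open>K\<^sub>m(T\<^sub>a)\<close> for the Laurent polynomial
  \<open>K\<^sub>m(z) = \<Sum>j=-(m-1)..m-1. (m-|j|) z^j\<close>.\<close>

definition K_shift :: "nat \<Rightarrow> complex fps \<Rightarrow> qseries \<Rightarrow> qseries"
  where "K_shift m a F =
    (\<Sum>j\<in>{- (int m - 1)..int m - 1}. of_int (int m - \<bar>j\<bar>) * shift (of_int j * a) F)"

definition gv_support :: "(nat \<Rightarrow> int) \<Rightarrow> nat set"
  where "gv_support n = {d. d \<ge> 1 \<and> n d \<noteq> 0}"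

definition F_loc :: "(nat \<Rightarrow> int) \<Rightarrow> qseries"
  where "F_loc n = (\<Sum>d\<in>gv_support n. of_int (n d) * Phi d)"

lemma scal_mult_nth: "fps_nth (scal c * F) N = fls_const c * fps_nth F N"
  by (simp add: scal_def)

lemma D_q_power: "D (q ^ N) = scal (\<i> * of_nat N) * q ^ N"
proof (rule fps_ext)
  fix M
  have *: "fps_nth (q * fps_deriv F) M = of_nat M * fps_nth F M" for F
    by (cases M) (simp_all add: q_def)
  have "fps_nth (D (q ^ N)) M
      = fls_const (1 / (2 * of_real pi)) * (fls_const (2 * of_real pi * \<i>) *
          (of_nat M * fps_nth (q ^ N) M))"
    by (simp only: D_def deriv_t_def scal_mult_nth mult.assoc[of "scal _"] *)
  also have "\<dots> = fls_const (\<i> * of_nat M) * fps_nth (q ^ N) M"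
    by (simp add: fls_of_nat fls_const_mult_const mult.assoc[symmetric])
  finally show "fps_nth (D (q ^ N)) M = fps_nth (scal (\<i> * of_nat N) * q ^ N) M"
    by (cases "M = N") (simp_all add: scal_mult_nth q_def fps_X_power_nth)
qed

lemma shift_q_power:
  "shift a (q ^ N) = fps_const (fps_to_fls (fps_exp (2 * of_real pi * \<i> * of_nat N) oo a)) * q ^ N"
  by (rule fps_ext) (simp add: shift_def q_def fps_X_power_nth)

lemma Phi_nth:
  assumes "d \<ge> 1"
  shows "fps_nth (Phi d) N = (if N > 0 \<and> d dvd N
    then 1 / (of_nat (N div d) * fps_to_fls (2 * fps_sin (of_nat (N div d) / 2)) ^ 2) else 0)"
  using assms by (auto simp: Phi_def q_def fps_nth_compose_X_power)

end

theory Submission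
  imports Defs
begin

text \<open>
  On the coefficient of \<open>q\<^sup>N\<close> with \<open>N = d k\<close>, every operator acts as multiplication by a Laurent
  polynomial in \<open>w = exp(\<i>k\<lambda>)\<close>: with \<open>m = d/g\<close>, \<open>\<Delta>\<^sub>g\<close> is \<open>w\<^sup>m - 2 + w\<^sup>-\<^sup>m\<close> and \<open>K\<^sub>m(T\<^sub>h\<^sub>/\<^sub>d)\<close> is
  \<open>K\<^sub>m(w)\<close>. Since \<open>(2 sin(k\<lambda>/2))\<^sup>2 = -(w - 2 + w\<^sup>-\<^sup>1)\<close>, the claim is the Fejer identity
  \<open>K\<^sub>m(w) (w - 2 + w\<^sup>-\<^sup>1) = w\<^sup>m - 2 + w\<^sup>-\<^sup>m\<close>. The form with \<open>Li\<^sub>3\<close> follows because \<open>D\<^sup>2\<close> multiplies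
  this coefficient by \<open>-(d k)\<^sup>2\<close>.
\<close>

text \<open>Induction adds the two end terms \<open>j = m + 1\<close> and
  \<open>j = - (m + 1)\<close>; the first differences telescope, leaving one at each end.\<close>

lemma sum_second_difference:
  fixes f :: "int \<Rightarrow> 'a :: comm_ring_1"
  shows "(\<Sum>j\<in>{- int m..int m}. f (j + 1) - 2 * f j + f (j - 1)) =
    f (int m + 1) - f (int m) - f (- int m) + f (- int m - 1)"
proof (induction m)
  case 0
  then show ?case by simp
next
  case (Suc m)
  have "{- int (Suc m)..int (Suc m)} =
      insert (- int (Suc m)) (insert (int (Suc m)) {- int m..int m})"
    by auto
  then show ?case
    using Suc.IH by (simp add: algebra_simps) (rule arg_cong[where f = f], simp)
qed

text \<open>Passing from \<open>m\<close> to \<open>m + 1\<close> raises every weight by one, so the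
  increment is the unweighted sum just computed. Taking \<open>f j\<close> to be the power
  \<open>w^j\<close> gives the Fejer identity; an arbitrary \<open>f\<close> avoids negative
  powers.\<close>

lemma sum_fejer_second_difference:
  fixes f :: "int \<Rightarrow> 'a :: comm_ring_1"
  shows "(\<Sum>j\<in>{- (int m - 1)..int m - 1}.
      of_int (int m - \<bar>j\<bar>) * (f (j + 1) - 2 * f j + f (j - 1))) =
    f (int m) - 2 * f 0 + f (- int m)"
proof (induction m)
  case 0
  then show ?case by simp
next
  case (Suc m)
  let ?d = "\<lambda>j. f (j + 1) - 2 * f j + f (j - 1)"
  have "(\<Sum>j\<in>{- (int (Suc m) - 1)..int (Suc m) - 1}. of_int (int (Suc m) - \<bar>j\<bar>) * ?d j) =
      (\<Sum>j\<in>{- int m..int m}. of_int (int m - \<bar>j\<bar>) * ?d j) + (\<Sum>j\<in>{- int m..int m}. ?d j)"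
    by (simp add: sum.distrib[symmetric] algebra_simps)
  \<comment> \<open>The range can shrink because the weight vanishes at both ends.\<close>
  also have "(\<Sum>j\<in>{- int m..int m}. of_int (int m - \<bar>j\<bar>) * ?d j) =
      (\<Sum>j\<in>{- (int m - 1)..int m - 1}. of_int (int m - \<bar>j\<bar>) * ?d j)"
  proof (rule sum.mono_neutral_right)
    have "\<bar>j\<bar> = int m" if "j \<in> {- int m..int m} - {- (int m - 1)..int m - 1}" for j
      using that by auto
    then show "\<forall>j\<in>{- int m..int m} - {- (int m - 1)..int m - 1}.
        of_int (int m - \<bar>j\<bar>) * ?d j = 0"
      by simp
  qed auto
  finally show ?case
    unfolding Suc.IH sum_second_difference
    by (simp add: algebra_simps del: of_int_diff) (rule arg_cong[where f = f], simp)
qed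

text \<open>With \<open>c\<close> scaled by an integer \<open>j\<close>, this serves as the power
  \<open>w^j\<close> for either sign of \<open>j\<close>.\<close>

definition fls_exp :: "complex \<Rightarrow> complex fls"
  where "fls_exp c = fps_to_fls (fps_exp c)"

lemma fls_exp_0 [simp]: "fls_exp 0 = 1"
  by (simp add: fls_exp_def)

lemma fls_exp_add: "fls_exp (a + b) = fls_exp a * fls_exp b"
  by (simp add: fls_exp_def fps_exp_add_mult fls_times_fps_to_fls)

lemma fejer_fls_exp:
  "(\<Sum>j\<in>{- (int m - 1)..int m - 1}. of_int (int m - \<bar>j\<bar>) * fls_exp (of_int j * c)) *
      (fls_exp c - 2 + fls_exp (- c)) =
    fls_exp (of_nat m * c) - 2 + fls_exp (- (of_nat m * c))"
proof -
  have step: "fls_exp (of_int j * c) * (fls_exp c - 2 + fls_exp (- c)) =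
      fls_exp (of_int (j + 1) * c) - 2 * fls_exp (of_int j * c) + fls_exp (of_int (j - 1) * c)"
    for j
    using fls_exp_add[of "of_int j * c" c] fls_exp_add[of "of_int j * c" "- c"]
    by (simp add: algebra_simps)
  show ?thesis
    unfolding sum_distrib_right mult.assoc step
    by (subst sum_fejer_second_difference) simp
qed

text \<open>Euler's formula writes the sine as a difference of half-angle exponentials; squaring
  doubles the exponents and the cross term gives the constant 2.\<close>

lemma fls_sin_squared:
  "fps_to_fls (2 * fps_sin (c / 2)) ^ 2 = - (fls_exp (\<i> * c) - 2 + fls_exp (- (\<i> * c)))"
proof -
  have "(2 * fps_sin (c / 2)) =
      fps_const (- \<i>) * (fps_exp (\<i> * c / 2) - fps_exp (- (\<i> * c / 2)))"
    by (simp add: fps_sin_fps_exp_ii fps_eq_iff fps_numeral_fps_const field_simps)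
  moreover have "fps_exp (\<i> * c / 2) * fps_exp (\<i> * c / 2) = fps_exp (\<i> * c)"
    "fps_exp (- (\<i> * c / 2)) * fps_exp (- (\<i> * c / 2)) = fps_exp (- (\<i> * c))"
    "fps_exp (\<i> * c / 2) * fps_exp (- (\<i> * c / 2)) = 1"
    by (simp_all flip: fps_exp_add_mult)
  moreover have "fps_const (- \<i>) * fps_const (- \<i>) = - 1"
    by (simp add: fps_eq_iff)
  ultimately have "(2 * fps_sin (c / 2)) ^ 2 = - (fps_exp (\<i> * c) - 2 + fps_exp (- (\<i> * c)))"
    by algebra
  from arg_cong[OF this, of fps_to_fls] show ?thesis
    by (simp add: fls_exp_def flip: fps_to_fls_power)
qed

text \<open>The linear coefficient is \<open>c\<close>.\<close>

lemma fps_sin_nonzero: "c \<noteq> 0 \<Longrightarrow> fps_sin (c :: complex) \<noteq> 0"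
  by (auto simp: fps_eq_iff fps_sin_def intro!: exI[of _ 1])

text \<open>The factor 2 pi in the exponent of \<open>shift\<close> cancels the one in the
  denominator of \<open>h\<close>.\<close>

lemma shift_nth:
  "fps_nth (shift (fps_const c * h) F) N = fls_exp (\<i> * c * of_nat N) * fps_nth F N"
proof -
  have "fps_const c * h = fps_const (c / (2 * of_real pi)) * fps_X"
    by (simp add: h_def flip: mult.assoc)
  moreover have "fps_exp a oo (fps_const b * fps_X) = fps_exp (a * b)" for a b :: complex
    by (simp add: fps_compose_linear fps_eq_iff power_mult_distrib)
  ultimately show ?thesis
    by (simp add: shift_def fls_exp_def mult_ac)
qed

lemma Delta_nth:
  "fps_nth (Delta g F) N =
    (fls_exp (\<i> * of_nat N / of_nat g) - 2 + fls_exp (- (\<i> * of_nat N / of_nat g))) * fps_nth F N"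
proof -
  have "- (fps_const (1 / of_nat g) * h) = fps_const (- 1 / of_nat g) * h"
    by (simp flip: fps_const_neg)
  then show ?thesis
    by (simp add: Delta_def shift_nth ring_distribs numeral_fps_const)
qed

lemma K_shift_nth:
  "fps_nth (K_shift m (fps_const c * h) F) N =
    (\<Sum>j\<in>{- (int m - 1)..int m - 1}.
      of_int (int m - \<bar>j\<bar>) * fls_exp (of_int j * (\<i> * c * of_nat N))) * fps_nth F N"
proof -
  have "of_int j * (fps_const c * h) = fps_const (of_int j * c) * h" for j
    by (simp flip: fps_of_int fps_const_mult)
  then have shift_j: "fps_nth (shift (of_int j * (fps_const c * h)) F) N =
      fls_exp (of_int j * (\<i> * c * of_nat N)) * fps_nth F N" for j
    by (simp only: shift_nth) (simp only: mult_ac)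
  have "fps_nth (of_int j * G) N = of_int j * fps_nth G N" for j and G :: qseries
    by (simp flip: fps_of_int)
  then show ?thesis
    unfolding K_shift_def fps_sum_nth sum_distrib_right by (simp only: shift_j mult.assoc)
qed

lemma D_nth: "fps_nth (D F) N = fls_const (\<i> * of_nat N) * fps_nth F N"
proof -
  have "fps_nth (q * fps_deriv F) N = of_nat N * fps_nth F N"
    by (cases N) (simp_all add: q_def)
  then have "fps_nth (D F) N = fls_const (1 / (2 * of_real pi)) *
      (fls_const (2 * of_real pi * \<i>) * (of_nat N * fps_nth F N))"
    by (simp only: D_def deriv_t_def scal_mult_nth mult.assoc[of "scal _"])
  also have "\<dots> = fls_const (\<i> * of_nat N) * fps_nth F N"
    by (simp add: fls_of_nat fls_const_mult_const mult.assoc[symmetric])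
  finally show ?thesis .
qed

lemma polylog_nth:
  assumes "d \<ge> 1"
  shows "fps_nth (polylog s (q ^ d)) N =
    (if N > 0 \<and> d dvd N then fls_const (1 / of_nat (N div d) ^ s) else 0)"
  using assms by (auto simp: polylog_def q_def fps_nth_compose_X_power)

text \<open>Divisibility of \<open>d\<close> by \<open>g\<close> makes the exponent
  \<open>d div g\<close> exact, so the Fejer factor from \<open>Delta\<close> contains the squared
  sine in the denominator of \<open>Phi d\<close>.\<close>

lemma Delta_Phi:
  assumes "d \<ge> 1" "g dvd d"
  shows "Delta g (Phi d) =
    - K_shift (d div g) (fps_const (1 / of_nat d) * h) (polylog 1 (q ^ d))"
proof (rule fps_ext)
  fix N
  show "fps_nth (Delta g (Phi d)) N =
    fps_nth (- K_shift (d div g) (fps_const (1 / of_nat d) * h) (polylog 1 (q ^ d))) N"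
  proof (cases "N > 0 \<and> d dvd N")
    case False
    \<comment> \<open>Both series involve only positive powers of \<open>q ^ d\<close>, and the
      operators act diagonally.\<close>
    then show ?thesis
      using assms by (auto simp: Delta_nth K_shift_nth polylog_nth Phi_nth)
  next
    case True
    then obtain k where N: "N = d * k" and k: "k > 0"
      by (auto elim: dvdE)
    obtain m where m: "d = g * m" using assms by (auto elim: dvdE)
    have pos: "g > 0" "m > 0" using assms m by auto
    \<comment> \<open>Since \<open>N / g = m * k\<close> and \<open>N / d = k\<close>, both
      operators become expressions in w = \<open>fls_exp c\<close>.\<close>
    define c where "c = \<i> * of_nat k"
    define K where "K = (\<Sum>j\<in>{- (int m - 1)..int m - 1}.
      of_int (int m - \<bar>j\<bar>) * fls_exp (of_int j * c))"
    define s where "s = fls_exp c - 2 + fls_exp (- c)"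
    have sin: "fps_to_fls (2 * fps_sin (of_nat k / 2)) ^ 2 = - s"
      by (simp only: fls_sin_squared c_def s_def)
    \<comment> \<open>Cancelling \<open>s\<close> is legitimate because the sine series is
      nonzero.\<close>
    have "s \<noteq> 0"
    proof
      assume "s = 0"
      with sin have "2 * fps_sin (of_nat k / 2 :: complex) = 0" by simp
      with k fps_sin_nonzero[of "of_nat k / 2"] show False by simp
    qed
    have "fps_nth (Delta g (Phi d)) N =
        (fls_exp (of_nat m * c) - 2 + fls_exp (- (of_nat m * c))) * (1 / (of_nat k * - s))"
      using pos k assms(1)
      by (simp add: Delta_nth Phi_nth N sin) (simp add: m c_def mult_ac)
    also have "\<dots> = K * s * (1 / (of_nat k * - s))"
      by (simp only: K_def s_def fejer_fls_exp)
    also have "\<dots> = - (K * (1 / of_nat k))"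
      using \<open>s \<noteq> 0\<close> k by (simp add: field_simps)
    also have "1 / of_nat k = fls_const (1 / of_nat k :: complex)"
      using k by (simp add: fls_of_nat field_simps fls_const_mult_const)
    also have "- (K * fls_const (1 / of_nat k)) =
        fps_nth (- K_shift (d div g) (fps_const (1 / of_nat d) * h) (polylog 1 (q ^ d))) N"
      using pos k assms(1)
      by (simp add: K_shift_nth polylog_nth N K_def c_def) (simp add: m mult_ac)
    finally show ?thesis .
  qed
qed

text \<open>At \<open>N = d * k\<close> the factor \<open>(\<i> * N)^2\<close> equals
  \<open>- d^2 * k^2\<close>: it removes the \<open>1 / d^2\<close> and turns \<open>1 / k^3\<close>
  into \<open>- 1 / k\<close>.\<close>

lemma D_D_polylog_3:
  assumes "d \<ge> 1"
  shows "D (D (scal (a / of_nat d ^ 2) * K_shift m (fps_const c * h) (polylog 3 (q ^ d)))) =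
    - (scal a * K_shift m (fps_const c * h) (polylog 1 (q ^ d)))"
proof (rule fps_ext)
  fix N
  have "fls_const (\<i> * of_nat N) * (fls_const (\<i> * of_nat N) *
      (fls_const (a / of_nat d ^ 2) * fps_nth (polylog 3 (q ^ d)) N)) =
    - (fls_const a * fps_nth (polylog 1 (q ^ d)) N)"
  proof (cases "N > 0 \<and> d dvd N")
    case False
    then show ?thesis
      using assms by (auto simp: polylog_nth)
  next
    case True
    then obtain k where N: "N = d * k" and k: "k > 0"
      by (auto elim: dvdE)
    have "(\<i> * of_nat N) * ((\<i> * of_nat N) * (a / of_nat d ^ 2 * (1 / of_nat k ^ 3))) =
        - (a * (1 / of_nat k))"
      using assms k by (simp add: N field_simps power2_eq_square power3_eq_cube)
    with k assms show ?thesis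
      by (simp add: polylog_nth N fls_const_mult_const)
  qed
  \<comment> \<open>\<open>K_shift\<close> contributes the same scalar sum on both sides, which is
    moved out in front.\<close>
  then show "fps_nth (D (D (scal (a / of_nat d ^ 2) *
        K_shift m (fps_const c * h) (polylog 3 (q ^ d))))) N =
      fps_nth (- (scal a * K_shift m (fps_const c * h) (polylog 1 (q ^ d)))) N"
    by (simp add: D_nth scal_mult_nth K_shift_nth mult.left_commute[of _ "sum _ _"])
qed

lemma scal_of_int: "scal (of_int c) = of_int c"
  by (simp add: scal_def fls_of_int flip: fps_of_int)

lemma Delta_sum: "Delta g (\<Sum>d\<in>A. f d) = (\<Sum>d\<in>A. Delta g (f d))"
  by (rule fps_ext) (simp add: Delta_nth fps_sum_nth sum_distrib_left)

lemma Delta_scal_mult: "Delta g (scal c * F) = scal c * Delta g F"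
  by (rule fps_ext) (simp only: Delta_nth scal_mult_nth mult.left_commute)

lemma D_sum: "D (\<Sum>d\<in>A. f d) = (\<Sum>d\<in>A. D (f d))"
  by (rule fps_ext) (simp add: D_nth fps_sum_nth sum_distrib_left)

theorem theorem1p2:
  fixes n :: "nat \<Rightarrow> int" and l g :: nat and S :: "nat set"
  assumes "1 \<le> l" and "l \<le> 6"
    and "\<And>d. d > l \<Longrightarrow> n d = 0"
    and "S = gv_support n" and "S \<noteq> {}"
    and "g = Gcd S"
  shows "Delta g (F_loc n) =
      D (D (\<Sum>d\<in>S. scal (of_int (n d) / of_nat d ^ 2) *
        K_shift (d div g) (fps_const (1 / of_nat d) * h) (polylog 3 (q ^ d))))
    \<and> Delta g (F_loc n) =
      - (\<Sum>d\<in>S. of_int (n d) *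
        K_shift (d div g) (fps_const (1 / of_nat d) * h) (polylog 1 (q ^ d)))"
proof -
  have S: "d \<ge> 1" "g dvd d" if "d \<in> S" for d
    using that assms by (auto simp: gv_support_def)
  \<comment> \<open>Linearity reduces the claim to a single degree \<open>d\<close>; integer
    multiples are read as \<open>scal\<close> for this.\<close>
  have "Delta g (F_loc n) = (\<Sum>d\<in>S. scal (of_int (n d)) * Delta g (Phi d))"
    by (simp add: F_loc_def assms(4) Delta_sum Delta_scal_mult flip: scal_of_int)
  also have "\<dots> = - (\<Sum>d\<in>S. scal (of_int (n d)) *
      K_shift (d div g) (fps_const (1 / of_nat d) * h) (polylog 1 (q ^ d)))"
    unfolding sum_negf[symmetric] by (rule sum.cong) (simp_all add: Delta_Phi S del: One_nat_def)
  finally have Li_1: "Delta g (F_loc n) = \<dots>" .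
  also have "\<dots> = D (D (\<Sum>d\<in>S. scal (of_int (n d) / of_nat d ^ 2) *
      K_shift (d div g) (fps_const (1 / of_nat d) * h) (polylog 3 (q ^ d))))"
    unfolding D_sum sum_negf[symmetric] by (rule sum.cong) (simp_all only: D_D_polylog_3 S)
  finally show ?thesis
    using Li_1 by (simp only: scal_of_int)
qed

end
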